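(* For each integer dimension $d\ge2$ and all real parameters $0<a<\ell$, the volume of the polar dual of the isocanted cube $\mathcal{I}_d(\ell,a)$ is $$\operatorname{vol}_d\mathcal{I}_d^\circ(\ell,a)= \frac{2^{d+1}}{\ell^d\, d!}\sum_{j=0}^{d-1}\binom{d+j-1}{j}\left(\frac{\ell}{2(\ell-a)}\right)^j,$$ a rational expression in $\ell,a$, homogeneous of degree $-d$.
   Context: For an integer $d\ge2$ and real numbers $0<a<\ell$, the isocanted cube $\mathcal{I}_d(\ell,a)\subseteq\mathbb{R}^d$ is the convex polytope $$\mathcal{I}_d(\ell,a)=\Big\{x\in\mathbb{R}^d:\ -\tfrac{\ell}{2}\le x_j\le \tfrac{\ell}{2},\ \ a-\ell\le x_j-x_k\le \ell-a\ \text{ for all } j,k\in\{1,\dots,d\},\ j\ne k\Big\}.$$ The polar dual of a set $K\subseteq\mathbb{R}^d$ is $K^\circ:=\{x\in\mathbb{R}^d:\langle x,y\rangle\le 1\ \forall y\in K\}$, with the usual inner product, and $\mathcal{I}_d^\circ(\ell,a):=(\mathcal{I}_d(\ell,a))^\circ$. $\operatorname{vol}_d$ is $d$-dimensional Lebesgue measure. *)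

theory Defs
  imports "HOL-Analysis.Analysis" "HOL-Computational_Algebra.Polynomial"
begin

definition isocanted_cube :: "real \<Rightarrow> real \<Rightarrow> (real ^ 'd) set" where
  "isocanted_cube l a =
     {x. (\<forall>j. - (l / 2) \<le> x $ j \<and> x $ j \<le> l / 2) \<and>
         (\<forall>j k. j \<noteq> k \<longrightarrow> a - l \<le> x $ j - x $ k \<and> x $ j - x $ k \<le> l - a)}"

definition polar_dual :: "('a::real_inner) set \<Rightarrow> 'a set" where
  "polar_dual K = {x. \<forall>y\<in>K. x \<bullet> y \<le> 1}"

text \<open>A polynomial in two variables is represented as a polynomial in the second
  variable whose coefficients are polynomials in the first.\<close>

definition poly2 :: "real poly poly \<Rightarrow> real \<Rightarrow> real \<Rightarrow> real" where
  "poly2 p x y = poly (poly p [:y:]) x"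

definition rational_on :: "(real \<times> real) set \<Rightarrow> (real \<Rightarrow> real \<Rightarrow> real) \<Rightarrow> bool" where
  "rational_on S f \<longleftrightarrow>
     (\<exists>p q. \<forall>(x, y)\<in>S. poly2 q x y \<noteq> 0 \<and> f x y = poly2 p x y / poly2 q x y)"

text \<open>Intended for sets closed under multiplication by nonzero scalars.\<close>

definition homogeneous_on :: "(real \<times> real) set \<Rightarrow> int \<Rightarrow> (real \<Rightarrow> real \<Rightarrow> real) \<Rightarrow> bool" where
  "homogeneous_on S k f \<longleftrightarrow>
     (\<forall>(x, y)\<in>S. \<forall>t. t \<noteq> 0 \<longrightarrow> f (t * x) (t * y) = t powi k * f x y)"

end

theory Submission
  imports Defs "HOL-Probability.Distributions" "HOL-Real_Asymp.Real_Asymp"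
begin

text \<open>
  The support function of the isocanted cube is
  \<open>h y = (a / 2) * \<bar>\<Sum>i. y i\<bar> + ((l - a) / 2) * (\<Sum>i. \<bar>y i\<bar>)\<close>, so the polar dual is its
  sublevel set at \<open>1\<close>, and since \<open>h\<close> is positively homogeneous, \<open>d!\<close> times the volume is the
  integral of \<open>exp (- h)\<close>. Put \<open>b = (l - a) / 2\<close>. Up to normalisation each factor
  \<open>exp (- b * \<bar>y i\<bar>)\<close> is a Laplace density, i.e. the density of a difference of two independent
  exponential variables, so the sum of the coordinates is distributed as \<open>P - N\<close> with \<open>P\<close> and \<open>N\<close>
  independent Erlang variables of shape \<open>d\<close>. The integral becomes an expectation of
  \<open>exp (- (a / 2) * \<bar>P - N\<bar>)\<close>; substituting \<open>P = N + x\<close> on the half \<open>P \<ge> N\<close> and expanding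
  \<open>(N + x) ^ (d - 1)\<close> binomially yields the stated sum.
\<close>

section \<open>Erlang and Laplace distributions\<close>

text \<open>The index is one less than the shape: \<open>erlang 0 b\<close> is the exponential
  distribution of rate \<open>b\<close>, and shape \<open>d\<close> is
  \<open>erlang (d - 1) b\<close>.\<close>

abbreviation erlang :: "nat \<Rightarrow> real \<Rightarrow> real measure" where
  "erlang k b \<equiv> density lborel (\<lambda>x. ennreal (erlang_density k b x))"

text \<open>Convolving Erlang laws of equal rate adds their shapes \<open>j + 1\<close> and
  \<open>k + 1\<close>; in terms of indices this gives \<open>Suc (j + k)\<close>.\<close>

lemma nn_integral_erlang_add:
  assumes b: "0 < b" and F [measurable]: "F \<in> borel_measurable borel"
  shows "(\<integral>\<^sup>+p. \<integral>\<^sup>+q. F (p + q) \<partial>erlang k b \<partial>erlang j b) = (\<integral>\<^sup>+x. F x \<partial>erlang (Suc (j + k)) b)"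
proof -
  have fin: "finite_measure (erlang i b)" for i
    using prob_space_erlang_density[OF b] by (simp add: prob_space.finite_measure)
  have "(\<integral>\<^sup>+p. \<integral>\<^sup>+q. F (p + q) \<partial>erlang k b \<partial>erlang j b) = (\<integral>\<^sup>+x. F x \<partial>(erlang j b \<star> erlang k b))"
    using fin by (intro nn_integral_convolution [symmetric]) auto
  also have "erlang j b \<star> erlang k b = erlang (Suc (j + k)) b"
    using fin convolution_erlang_density[OF b, of j k] by (subst convolution_density) auto
  finally show ?thesis .
qed

lemma nn_integral_erlang_swap:
  assumes b: "0 < b" and [measurable]: "case_prod F \<in> borel_measurable (borel \<Otimes>\<^sub>M borel)"
  shows "(\<integral>\<^sup>+p. \<integral>\<^sup>+q. F p q \<partial>erlang k b \<partial>erlang j b) = (\<integral>\<^sup>+q. \<integral>\<^sup>+p. F p q \<partial>erlang j b \<partial>erlang k b)"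
proof -
  interpret J: prob_space "erlang j b" by (rule prob_space_erlang_density[OF b])
  interpret K: prob_space "erlang k b" by (rule prob_space_erlang_density[OF b])
  interpret pair_sigma_finite "erlang j b" "erlang k b" ..
  show ?thesis by (rule Fubini'[symmetric]) simp
qed

text \<open>This autocorrelation of the exponential density is a Laplace density. The two factors
  vanish below \<open>0\<close> and \<open>- x\<close> respectively, so the integration starts at
  \<open>max 0 (- x)\<close>, and \<open>2 * max 0 (- x) + x = \<bar>x\<bar>\<close> produces the
  absolute value.\<close>

lemma nn_integral_erlang_0_mult_shift:
  assumes b: "0 < b"
  shows "(\<integral>\<^sup>+n. ennreal (erlang_density 0 b n) * ennreal (erlang_density 0 b (n + x)) \<partial>lborel)
    = ennreal (b / 2 * exp (- (b * \<bar>x\<bar>)))"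
proof -
  let ?a = "max 0 (- x)"
  have "(\<integral>\<^sup>+n. ennreal (erlang_density 0 b n) * ennreal (erlang_density 0 b (n + x)) \<partial>lborel)
     = (\<integral>\<^sup>+n. ennreal (b\<^sup>2 * exp (- b * (2 * n + x))) * indicator {?a..} n \<partial>lborel)"
    using b by (intro nn_integral_cong)
      (auto simp: erlang_density_def ennreal_mult'[symmetric] power2_eq_square exp_add [symmetric]
        algebra_simps split: split_indicator)
  also have "\<dots> = ennreal (0 - (- (b / 2) * exp (- b * (2 * ?a + x))))"
  proof (rule nn_integral_FTC_atLeast)
    show "((\<lambda>n. - (b / 2) * exp (- b * (2 * n + x))) has_real_derivative b\<^sup>2 * exp (- b * (2 * n + x))) (at n)" for n
      by (auto intro!: derivative_eq_intros simp: power2_eq_square)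
    show "((\<lambda>n. - (b / 2) * exp (- b * (2 * n + x))) \<longlongrightarrow> 0) at_top"
      using b by real_asymp
  qed auto
  also have "0 - (- (b / 2) * exp (- b * (2 * ?a + x))) = b / 2 * exp (- (b * \<bar>x\<bar>))"
    by (auto simp: max_def abs_if algebra_simps)
  finally show ?thesis .
qed

abbreviation laplace_density :: "real \<Rightarrow> real \<Rightarrow> real" where
  "laplace_density b x \<equiv> b / 2 * exp (- (b * \<bar>x\<bar>))"

text \<open>Substituting \<open>p = n + x\<close> for fixed \<open>n\<close> and then integrating
  over \<open>n\<close> first leaves the autocorrelation above as the weight of
  \<open>F x\<close>.\<close>

lemma nn_integral_laplace_eq_erlang:
  assumes b: "0 < b" and F [measurable]: "F \<in> borel_measurable borel"
  shows "(\<integral>\<^sup>+x. ennreal (laplace_density b x) * F x \<partial>lborel)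
    = (\<integral>\<^sup>+p. \<integral>\<^sup>+n. F (p - n) \<partial>erlang 0 b \<partial>erlang 0 b)"
proof -
  let ?e = "\<lambda>x. ennreal (erlang_density 0 b x)"
  have "(\<integral>\<^sup>+p. \<integral>\<^sup>+n. F (p - n) \<partial>erlang 0 b \<partial>erlang 0 b)
      = (\<integral>\<^sup>+n. \<integral>\<^sup>+p. F (p - n) \<partial>erlang 0 b \<partial>erlang 0 b)"
    using b by (rule nn_integral_erlang_swap) measurable
  also have "\<dots> = (\<integral>\<^sup>+n. ?e n * (\<integral>\<^sup>+p. ?e p * F (p - n) \<partial>lborel) \<partial>lborel)"
    by (simp add: nn_integral_density)
  also have "\<dots> = (\<integral>\<^sup>+n. \<integral>\<^sup>+x. ?e n * ?e (n + x) * F x \<partial>lborel \<partial>lborel)"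
  proof (rule nn_integral_cong)
    fix n :: real
    have "(\<integral>\<^sup>+p. ?e p * F (p - n) \<partial>lborel) = (\<integral>\<^sup>+x. ?e (n + x) * F x \<partial>lborel)"
      by (subst nn_integral_real_affine[where c = 1 and t = n]) auto
    then show "?e n * (\<integral>\<^sup>+p. ?e p * F (p - n) \<partial>lborel) = (\<integral>\<^sup>+x. ?e n * ?e (n + x) * F x \<partial>lborel)"
      by (simp add: nn_integral_cmult mult.assoc)
  qed
  also have "\<dots> = (\<integral>\<^sup>+x. \<integral>\<^sup>+n. ?e n * ?e (n + x) * F x \<partial>lborel \<partial>lborel)"
    by (rule lborel_pair.Fubini'[symmetric]) measurable
  also have "\<dots> = (\<integral>\<^sup>+x. ennreal (laplace_density b x) * F x \<partial>lborel)"
    by (simp add: nn_integral_multc nn_integral_erlang_0_mult_shift[OF b])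
  finally show ?thesis by simp
qed

text \<open>Induction on the index set: the new coordinate contributes \<open>p' - n'\<close>, the
  others \<open>p - n\<close>, and \<open>(p' + p) - (n' + n)\<close> is again a difference of two
  Erlang variables, with both shapes raised by one. \<open>F\<close> stays arbitrary because the
  induction hypothesis is applied to translates of it.\<close>

lemma nn_integral_prod_laplace_sum:
  fixes I :: "'i set"
  assumes b: "0 < b" and I: "finite I" "I \<noteq> {}" and F: "F \<in> borel_measurable borel"
  shows "(\<integral>\<^sup>+x. (\<Prod>i\<in>I. ennreal (laplace_density b (x i))) * F (\<Sum>i\<in>I. x i) \<partial>(\<Pi>\<^sub>M i\<in>I. lborel))
    = (\<integral>\<^sup>+p. \<integral>\<^sup>+n. F (p - n) \<partial>erlang (card I - 1) b \<partial>erlang (card I - 1) b)"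
  using I F
proof (induction I arbitrary: F rule: finite_ne_induct)
  case (singleton i)
  note [measurable] = singleton.prems
  interpret product_sigma_finite "\<lambda>_::'i. lborel :: real measure" by standard
  show ?case
    using nn_integral_laplace_eq_erlang[OF b singleton.prems]
      product_nn_integral_singleton[of "\<lambda>x. ennreal (laplace_density b x) * F x" i]
    by simp
next
  case (insert i I)
  note [measurable] = insert.prems
  interpret product_sigma_finite "\<lambda>_::'i. lborel :: real measure" by standard
  let ?P = "\<lambda>I x. \<Prod>i\<in>I. ennreal (laplace_density b (x i))"
  obtain k where k: "card I = Suc k"
    using insert by (metis card_eq_0_iff not0_implies_Suc)
  let ?E = "\<lambda>k. erlang k b"
  interpret E0: prob_space "?E 0" by (rule prob_space_erlang_density[OF b])
  interpret E: prob_space "?E k" by (rule prob_space_erlang_density[OF b])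
  interpret E': prob_space "?E (Suc k)" by (rule prob_space_erlang_density[OF b])
  have [measurable]: "finite I" using insert by simp
  note IH = insert.IH[unfolded k diff_Suc_1]
  have "(\<integral>\<^sup>+x. ?P (insert i I) x * F (\<Sum>j\<in>insert i I. x j) \<partial>(\<Pi>\<^sub>M i\<in>insert i I. lborel))
      = (\<integral>\<^sup>+y. \<integral>\<^sup>+x. ?P (insert i I) (x(i := y)) * F (\<Sum>j\<in>insert i I. (x(i := y)) j) \<partial>(\<Pi>\<^sub>M i\<in>I. lborel) \<partial>lborel)"
    using insert.hyps by (intro product_nn_integral_insert_rev) auto
  also have "\<dots> = (\<integral>\<^sup>+y. \<integral>\<^sup>+x. ennreal (laplace_density b y) * (?P I x * F (y + (\<Sum>j\<in>I. x j))) \<partial>(\<Pi>\<^sub>M i\<in>I. lborel) \<partial>lborel)"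
  proof (intro nn_integral_cong)
    fix y and x :: "'i \<Rightarrow> real"
    have "(x(i := y)) j = x j" if "j \<in> I" for j
      using that insert.hyps by auto
    then have "?P I (x(i := y)) = ?P I x" and "(\<Sum>j\<in>I. (x(i := y)) j) = (\<Sum>j\<in>I. x j)"
      by (simp_all del: fun_upd_apply cong: prod.cong sum.cong)
    then show "?P (insert i I) (x(i := y)) * F (\<Sum>j\<in>insert i I. (x(i := y)) j)
      = ennreal (laplace_density b y) * (?P I x * F (y + (\<Sum>j\<in>I. x j)))"
      using insert.hyps by (simp add: mult.assoc del: fun_upd_apply) simp
  qed
  also have "\<dots> = (\<integral>\<^sup>+y. ennreal (laplace_density b y) * (\<integral>\<^sup>+x. ?P I x * F (y + (\<Sum>j\<in>I. x j)) \<partial>(\<Pi>\<^sub>M i\<in>I. lborel)) \<partial>lborel)"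
    by (intro nn_integral_cong nn_integral_cmult) measurable
  \<comment> \<open>The induction hypothesis is used for \<open>\<lambda>z. F (y + z)\<close> with
    \<open>y\<close> fixed.\<close>
  also have "\<dots> = (\<integral>\<^sup>+y. ennreal (laplace_density b y) * (\<integral>\<^sup>+p. \<integral>\<^sup>+n. F (y + (p - n)) \<partial>?E k \<partial>?E k) \<partial>lborel)"
    by (intro nn_integral_cong arg_cong2[where f = "(*)"] refl IH) measurable
  also have "\<dots> = (\<integral>\<^sup>+p'. \<integral>\<^sup>+n'. \<integral>\<^sup>+p. \<integral>\<^sup>+n. F ((p' - n') + (p - n)) \<partial>?E k \<partial>?E k \<partial>?E 0 \<partial>?E 0)"
    by (rule nn_integral_laplace_eq_erlang[OF b]) measurable
  \<comment> \<open>Exchanging \<open>n'\<close> and \<open>p\<close> makes the variables to be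
    added adjacent: first \<open>n'\<close> with \<open>n\<close>, then \<open>p'\<close> with
    \<open>p\<close>.\<close>
  also have "\<dots> = (\<integral>\<^sup>+p'. \<integral>\<^sup>+p. \<integral>\<^sup>+n'. \<integral>\<^sup>+n. F ((p' + p) - (n' + n)) \<partial>?E k \<partial>?E 0 \<partial>?E k \<partial>?E 0)"
    by (intro nn_integral_cong, subst nn_integral_erlang_swap[OF b])
       (auto simp: algebra_simps)
  also have "\<dots> = (\<integral>\<^sup>+p'. \<integral>\<^sup>+p. \<integral>\<^sup>+n. F ((p' + p) - n) \<partial>?E (Suc k) \<partial>?E k \<partial>?E 0)"
    using nn_integral_erlang_add[OF b, of "\<lambda>n. F (_ - n)" 0 k] by simp
  also have "\<dots> = (\<integral>\<^sup>+p. \<integral>\<^sup>+n. F (p - n) \<partial>?E (Suc k) \<partial>?E (Suc k))"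
    using nn_integral_erlang_add[OF b, of "\<lambda>p. \<integral>\<^sup>+n. F (p - n) \<partial>?E (Suc k)" 0 k] by simp
  finally show ?case using insert.hyps k by simp
qed

section \<open>Volumes of sublevel sets from exponential integrals\<close>

lemma nn_integral_power_exp_Ici:
  assumes c: "0 < (c::real)"
  shows "(\<integral>\<^sup>+x. ennreal (x ^ k * exp (- (c * x))) * indicator {0..} x \<partial>lborel)
    = ennreal (fact k / c ^ Suc k)"
proof -
  have [simp]: "indicator {0..} (x / c) = (indicator {0..} x :: ennreal)" for x
    using c by (auto simp: zero_le_divide_iff split: split_indicator)
  have "(\<integral>\<^sup>+x. ennreal (x ^ k * exp (- (c * x))) * indicator {0..} x \<partial>lborel)
      = ennreal (1 / c) * (\<integral>\<^sup>+x. ennreal (1 / c ^ k) * (ennreal (x ^ k * exp (- x)) * indicator {0..} x) \<partial>lborel)"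
    using c by (subst nn_integral_real_affine[where c = "1 / c" and t = 0])
      (auto simp: power_divide ennreal_mult'[symmetric] mult.assoc[symmetric])
  also have "\<dots> = ennreal (fact k / c ^ Suc k)"
    using c by (simp add: nn_integral_cmult nn_intergal_power_times_exp_Ici flip: ennreal_mult')
  finally show ?thesis .
qed

text \<open>By homogeneity the sublevel set at \<open>t\<close> is the dilate by \<open>t\<close> of
  the one at \<open>1\<close>.\<close>

lemma emeasure_lborel_scale_sublevel:
  fixes h :: "'a::euclidean_space \<Rightarrow> real"
  assumes [measurable]: "h \<in> borel_measurable borel"
    and hom: "\<And>t y. 0 < t \<Longrightarrow> h (t *\<^sub>R y) = t * h y" and t: "0 < t"
  shows "emeasure lborel {y. h y \<le> t} = ennreal (t ^ DIM('a)) * emeasure lborel {y. h y \<le> 1}"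
proof -
  have "emeasure lborel {y. h y \<le> t}
      = emeasure (density (distr lborel borel (\<lambda>x. 0 + t *\<^sub>R x)) (\<lambda>_. ennreal (\<bar>t\<bar> ^ DIM('a)))) {y. h y \<le> t}"
    using lborel_affine[of t "0::'a"] t by simp
  also have "\<dots> = ennreal (t ^ DIM('a)) * emeasure lborel ((\<lambda>x. t *\<^sub>R x) -` {y. h y \<le> t})"
    using t by (simp add: emeasure_density nn_integral_cmult_indicator emeasure_distr)
  also have "(\<lambda>x. t *\<^sub>R x) -` {y. h y \<le> t} = {y. h y \<le> 1}"
    using t by (auto simp: hom)
  finally show ?thesis .
qed

text \<open>Layer-cake argument: \<open>exp (- h y)\<close> is the integral of
  \<open>exp (- t)\<close> over \<open>t \<ge> h y\<close>. After exchanging the integrals, the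
  inner one is a sublevel volume, which scales like \<open>t ^ DIM('a)\<close>, and the Gamma
  integral over \<open>t\<close> gives the factorial.\<close>

lemma nn_integral_exp_minus_gauge:
  fixes h :: "'a::euclidean_space \<Rightarrow> real"
  assumes [measurable]: "h \<in> borel_measurable borel" and nonneg: "\<And>y. 0 \<le> h y"
    and hom: "\<And>t y. 0 < t \<Longrightarrow> h (t *\<^sub>R y) = t * h y"
  shows "(\<integral>\<^sup>+y. ennreal (exp (- h y)) \<partial>lborel) = fact DIM('a) * emeasure lborel {y. h y \<le> 1}"
proof -
  let ?n = "DIM('a)"
  have "(\<integral>\<^sup>+y. ennreal (exp (- h y)) \<partial>lborel)
      = (\<integral>\<^sup>+y. \<integral>\<^sup>+t. ennreal (exp (- t)) * indicator {h y..} t \<partial>lborel \<partial>lborel)"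
  proof (rule nn_integral_cong)
    fix y
    have "(\<integral>\<^sup>+t. ennreal (exp (- t)) * indicator {h y..} t \<partial>lborel) = ennreal (0 - (- exp (- h y)))"
      by (rule nn_integral_FTC_atLeast) (auto intro!: derivative_eq_intros, real_asymp)
    then show "ennreal (exp (- h y)) = (\<integral>\<^sup>+t. ennreal (exp (- t)) * indicator {h y..} t \<partial>lborel)" by simp
  qed
  also have "\<dots> = (\<integral>\<^sup>+t. \<integral>\<^sup>+y. ennreal (exp (- t)) * indicator {h y..} t \<partial>lborel \<partial>lborel)"
    by (rule lborel_pair.Fubini') (simp add: indicator_def, measurable)
  also have "\<dots> = (\<integral>\<^sup>+t. ennreal (t ^ ?n * exp (- (1 * t))) * indicator {0..} t * emeasure lborel {y. h y \<le> 1} \<partial>lborel)"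
  \<comment> \<open>The scaling law covers only \<open>t > 0\<close>, and for \<open>t < 0\<close>
    the sublevel set is empty; the single point \<open>t = 0\<close> is discarded as a null
    set.\<close>
  proof (rule nn_integral_cong_AE, use AE_lborel_singleton[of 0] in eventually_elim)
    fix t :: real assume "t \<noteq> 0"
    have "(\<integral>\<^sup>+y. ennreal (exp (- t)) * indicator {h y..} t \<partial>lborel)
        = (\<integral>\<^sup>+y. ennreal (exp (- t)) * indicator {y. h y \<le> t} y \<partial>lborel)"
      by (intro nn_integral_cong) (auto split: split_indicator)
    also have "\<dots> = ennreal (exp (- t)) * emeasure lborel {y. h y \<le> t}"
      by (rule nn_integral_cmult_indicator) measurable
    also have "\<dots> = ennreal (t ^ ?n * exp (- (1 * t))) * indicator {0..} t * emeasure lborel {y. h y \<le> 1}"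
    proof (cases "t > 0")
      case True
      with emeasure_lborel_scale_sublevel[OF assms(1) hom, of t] show ?thesis
        by (simp add: ennreal_mult' mult_ac)
    next
      case False
      then have t: "t < 0" using \<open>t \<noteq> 0\<close> by simp
      then have "{y. h y \<le> t} = {}"
        using nonneg by (metis (mono_tags, lifting) Collect_empty_eq leD order_trans)
      then show ?thesis using t by simp
    qed
    finally show "(\<integral>\<^sup>+y. ennreal (exp (- t)) * indicator {h y..} t \<partial>lborel) = \<dots>" .
  qed
  also have "\<dots> = fact ?n * emeasure lborel {y. h y \<le> 1}"
    using nn_integral_power_exp_Ici[of 1 ?n] by (simp add: nn_integral_multc ennreal_fact)
  finally show ?thesis .
qed

section \<open>The polar dual as a sublevel set of the support function\<close>

lemma isocanted_cube_mem_uminus: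
  fixes x :: "real ^ 'd"
  shows "x \<in> isocanted_cube l a \<longleftrightarrow> - x \<in> isocanted_cube l a"
proof -
  have "- x \<in> isocanted_cube l a" if x: "x \<in> isocanted_cube l a" for x :: "real ^ 'd"
    unfolding isocanted_cube_def
  proof (intro CollectI conjI allI impI)
    fix j k :: 'd
    show "- (l / 2) \<le> (- x) $ j" "(- x) $ j \<le> l / 2"
      using x by (simp_all add: isocanted_cube_def minus_le_iff)
    assume "j \<noteq> k"
    then have "a - l \<le> x $ k - x $ j \<and> x $ k - x $ j \<le> l - a"
      using x unfolding isocanted_cube_def by simp
    then show "a - l \<le> (- x) $ j - (- x) $ k" "(- x) $ j - (- x) $ k \<le> l - a"
      by auto
  qed
  from this[of x] this[of "- x"] show ?thesis by auto
qed

text \<open>With \<open>M\<close> the largest coordinate of \<open>x\<close>, all coordinates lie in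
  the interval of midpoint \<open>M - (l - a) / 2\<close> and radius \<open>(l - a) / 2\<close>. So
  each \<open>x $ i * y $ i\<close> is at most midpoint times \<open>y $ i\<close> plus radius times
  \<open>\<bar>y $ i\<bar>\<close>. The midpoint is at most \<open>a / 2\<close>, which can be
  inserted after summation because the coordinate sum of \<open>y\<close> is nonnegative.\<close>

lemma isocanted_cube_inner_le:
  fixes x y :: "real ^ 'd"
  assumes x: "x \<in> isocanted_cube l a" and al: "a < l"
    and sg: "0 \<le> (\<Sum>i\<in>UNIV. y $ i)"
  shows "x \<bullet> y \<le> a / 2 * \<bar>\<Sum>i\<in>UNIV. y $ i\<bar> + (l - a) / 2 * (\<Sum>i\<in>UNIV. \<bar>y $ i\<bar>)"
proof -
  define M where "M = Max (range (\<lambda>i. x $ i))"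
  have le: "x $ i \<le> M" for i unfolding M_def by simp
  have "M \<in> range (\<lambda>i. x $ i)" unfolding M_def by (rule Max_in) auto
  then obtain k where k: "M = x $ k" by auto
  have M: "M \<le> l / 2" and ge: "M - x $ i \<le> l - a" for i
    \<comment> \<open>The cube bounds differences of distinct coordinates only; for
      \<open>k = i\<close> the claim is \<open>0 \<le> l - a\<close>.\<close>
    using x al unfolding isocanted_cube_def k by (auto, cases "k = i") auto
  have "x $ i * y $ i \<le> (M - (l - a) / 2) * y $ i + (l - a) / 2 * \<bar>y $ i\<bar>" for i
  proof (cases "0 \<le> y $ i")
    case True
    then show ?thesis using mult_right_mono[OF le[of i] True] by (simp add: algebra_simps)
  next
    case False
    then have "(x $ i - (M - (l - a))) * y $ i \<le> 0"
      using ge[of i] by (intro mult_nonneg_nonpos) auto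
    with False show ?thesis by (simp add: field_simps)
  qed
  then have "x \<bullet> y \<le> (\<Sum>i\<in>UNIV. (M - (l - a) / 2) * y $ i + (l - a) / 2 * \<bar>y $ i\<bar>)"
    unfolding inner_vec_def by (intro sum_mono) simp
  also have "\<dots> = (M - (l - a) / 2) * (\<Sum>i\<in>UNIV. y $ i) + (l - a) / 2 * (\<Sum>i\<in>UNIV. \<bar>y $ i\<bar>)"
    by (simp add: sum.distrib sum_distrib_left)
  also have "(M - (l - a) / 2) * (\<Sum>i\<in>UNIV. y $ i) \<le> a / 2 * (\<Sum>i\<in>UNIV. y $ i)"
    using M sg by (intro mult_right_mono) (auto simp: field_simps)
  finally show ?thesis using sg by simp
qed

lemma isocanted_cube_inner_attained:
  fixes y :: "real ^ 'd"
  assumes a: "0 < a" and al: "a < l" and sg: "0 \<le> (\<Sum>i\<in>UNIV. y $ i)"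
  obtains x where "x \<in> isocanted_cube l a"
    "x \<bullet> y = a / 2 * \<bar>\<Sum>i\<in>UNIV. y $ i\<bar> + (l - a) / 2 * (\<Sum>i\<in>UNIV. \<bar>y $ i\<bar>)"
proof
  \<comment> \<open>The two values are \<open>a / 2 + (l - a) / 2\<close> and
    \<open>a / 2 - (l - a) / 2\<close>, the ends of the extremal interval in the preceding bound,
    chosen by the sign of \<open>y $ i\<close>.\<close>
  let ?x = "\<chi> i. if 0 \<le> y $ i then l / 2 else a - l / 2"
  show "?x \<in> isocanted_cube l a"
    using a al by (auto simp: isocanted_cube_def)
  have "?x \<bullet> y = (\<Sum>i\<in>UNIV. a / 2 * y $ i + (l - a) / 2 * \<bar>y $ i\<bar>)"
    unfolding inner_vec_def by (intro sum.cong) (auto simp: field_simps)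
  then show "?x \<bullet> y = a / 2 * \<bar>\<Sum>i\<in>UNIV. y $ i\<bar> + (l - a) / 2 * (\<Sum>i\<in>UNIV. \<bar>y $ i\<bar>)"
    using sg by (simp add: sum.distrib sum_distrib_left)
qed

text \<open>A linear form is at most \<open>1\<close> on the cube iff its maximum there is. The
  bound and its attainment identify this maximum when the coordinate sum is nonnegative; the other
  sign follows because the cube and \<open>?h\<close> are invariant under negation.\<close>

lemma polar_dual_isocanted_cube:
  assumes a: "0 < a" and al: "a < l"
  shows "polar_dual (isocanted_cube l a :: (real ^ 'd) set)
    = {y. a / 2 * \<bar>\<Sum>i\<in>UNIV. y $ i\<bar> + (l - a) / 2 * (\<Sum>i\<in>UNIV. \<bar>y $ i\<bar>) \<le> 1}"
proof -
  let ?h = "\<lambda>y :: real ^ 'd. a / 2 * \<bar>\<Sum>i\<in>UNIV. y $ i\<bar> + (l - a) / 2 * (\<Sum>i\<in>UNIV. \<bar>y $ i\<bar>)"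
  have h_minus: "?h (- y) = ?h y" for y by (simp add: sum_negf)
  have le: "x \<bullet> y \<le> ?h y" if "x \<in> isocanted_cube l a" for x y
  proof (cases "0 \<le> (\<Sum>i\<in>UNIV. y $ i)")
    case True
    with that al show ?thesis by (intro isocanted_cube_inner_le)
  next
    case False
    then have "- x \<bullet> - y \<le> ?h (- y)"
      using that al by (intro isocanted_cube_inner_le) (auto simp: isocanted_cube_mem_uminus[symmetric] sum_negf)
    then show ?thesis unfolding h_minus by simp
  qed
  have attained: "\<exists>x\<in>isocanted_cube l a. x \<bullet> y = ?h y" for y
  proof (cases "0 \<le> (\<Sum>i\<in>UNIV. y $ i)")
    case True
    then show ?thesis using isocanted_cube_inner_attained[OF a al] by metis
  next
    case False
    then have "0 \<le> (\<Sum>i\<in>UNIV. (- y) $ i)" by (simp add: sum_negf)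
    then obtain x where x: "x \<in> isocanted_cube l a" "x \<bullet> - y = ?h (- y)"
      using isocanted_cube_inner_attained[OF a al] by blast
    have "- x \<bullet> y = ?h y" using x(2) unfolding h_minus by simp
    then show ?thesis using x(1) isocanted_cube_mem_uminus by blast
  qed
  have "(\<forall>x\<in>isocanted_cube l a. y \<bullet> x \<le> 1) \<longleftrightarrow> ?h y \<le> 1" for y
    using le[of _ y] attained[of y] by (metis inner_commute order_trans)
  then show ?thesis
    unfolding polar_dual_def by blast
qed

section \<open>Rationality and homogeneity of the volume formula\<close>

lemma poly2_arith:
  "poly2 (p + q) x y = poly2 p x y + poly2 q x y"
  "poly2 (p - q) x y = poly2 p x y - poly2 q x y"
  "poly2 (p * q) x y = poly2 p x y * poly2 q x y"
  "poly2 (p ^ n) x y = poly2 p x y ^ n"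
  "poly2 (sum f A) x y = (\<Sum>i\<in>A. poly2 (f i) x y)"
  by (simp_all add: poly2_def poly_sum)

lemma poly2_const_var:
  "poly2 [:[:c:]:] x y = c" "poly2 [:[:0, 1:]:] x y = x" "poly2 [:0, 1:] x y = y"
  by (simp_all add: poly2_def)

lemma polar_volume_rational_on:
  "rational_on {(l, a). l \<noteq> 0 \<and> l \<noteq> a}
    (\<lambda>l a. 2 ^ (d + 1) / (l ^ d * fact d) *
       (\<Sum>j = 0..d - 1. real ((d + j - 1) choose j) * (l / (2 * (l - a))) ^ j))"
proof -
  let ?C = "\<lambda>c::real. [:[:c:]:]" and ?L = "[:[:0, 1:]:] :: real poly poly" and ?A = "[:0, 1:] :: real poly poly"
  let ?D = "?C 2 * (?L - ?A)"
  \<comment> \<open>The highest power of \<open>2 * (l - a)\<close> in the denominators is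
    \<open>d - 1\<close>; clearing it leaves \<open>?D ^ (d - 1 - j)\<close> in the summands of
    \<open>?p\<close>.\<close>
  let ?q = "?L ^ d * ?C (fact d) * ?D ^ (d - 1)"
  let ?p = "?C (2 ^ (d + 1)) * (\<Sum>j = 0..d - 1. ?C (real ((d + j - 1) choose j)) * ?L ^ j * ?D ^ (d - 1 - j))"
  have "poly2 ?q l a \<noteq> 0 \<and> 2 ^ (d + 1) / (l ^ d * fact d) *
       (\<Sum>j = 0..d - 1. real ((d + j - 1) choose j) * (l / (2 * (l - a))) ^ j) = poly2 ?p l a / poly2 ?q l a"
    if "l \<noteq> 0" "l \<noteq> a" for l a
  proof -
    define D where "D = 2 * (l - a)"
    have D: "D \<noteq> 0" using that by (simp add: D_def)
    have q: "poly2 ?q l a = l ^ d * fact d * D ^ (d - 1)"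
      by (simp only: poly2_arith poly2_const_var D_def)
    have p: "poly2 ?p l a = 2 ^ (d + 1) * (\<Sum>j = 0..d - 1. real ((d + j - 1) choose j) * l ^ j * D ^ (d - 1 - j))"
      by (simp only: poly2_arith poly2_const_var D_def)
    have "1 / D ^ j = D ^ (d - 1 - j) / D ^ (d - 1)" if "j \<le> d - 1" for j
      using D power_add[of D "d - 1 - j" j] by (simp only: le_add_diff_inverse2[OF that]) (simp add: divide_simps)
    then have "(\<Sum>j = 0..d - 1. real ((d + j - 1) choose j) * (l / D) ^ j)
        = (\<Sum>j = 0..d - 1. real ((d + j - 1) choose j) * l ^ j * D ^ (d - 1 - j)) / D ^ (d - 1)"
      unfolding sum_divide_distrib power_divide
      by (intro sum.cong refl) (metis (no_types, lifting) atLeastAtMost_iff mult.assoc mult_1_right times_divide_eq_right)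
    then show ?thesis
      using D that unfolding p q D_def[symmetric] by simp
  qed
  then show ?thesis
    unfolding rational_on_def by (intro exI[of _ ?p] exI[of _ ?q]) auto
qed

text \<open>The quotient \<open>l / (2 * (l - a))\<close> is invariant under scaling, so only
  \<open>l ^ d\<close> contributes. The set \<open>D\<close> is arbitrary: where a denominator
  vanishes, division by zero yields \<open>0\<close> on both sides of the scaling.\<close>

lemma polar_volume_homogeneous_on:
  "homogeneous_on D (- int d)
    (\<lambda>l a. 2 ^ (d + 1) / (l ^ d * fact d) *
       (\<Sum>j = 0..d - 1. real ((d + j - 1) choose j) * (l / (2 * (l - a))) ^ j))"
proof -
  have "t * l / (2 * (t * l - t * a)) = l / (2 * (l - a))" if "t \<noteq> 0" for t l a :: real
  proof -
    have "2 * (t * l - t * a) = t * (2 * (l - a))" by (simp add: algebra_simps)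
    then show ?thesis using that by simp
  qed
  then show ?thesis
    unfolding homogeneous_on_def
    by (simp add: power_int_minus power_mult_distrib inverse_eq_divide split_beta)
qed

section \<open>The Erlang expectation and the resulting volume\<close>

text \<open>After \<open>p = n + x\<close>, the exponentials separate into
  \<open>exp (- (2 * b * n))\<close> and \<open>exp (- ((s + b) * x))\<close>. Expanding
  \<open>(n + x) ^ k\<close> separates the powers as well, so every term is a product of two Gamma
  integrals.\<close>

lemma nn_integral_erlang_ordered:
  assumes b: "0 < b" and s: "0 < s"
  shows "(\<integral>\<^sup>+n. \<integral>\<^sup>+p. ennreal (exp (- (s * (p - n)))) * indicator {n..} p \<partial>erlang k b \<partial>erlang k b)
    = ennreal (b ^ (2 * Suc k) * (\<Sum>i\<le>k. real ((k + i) choose i) / ((2 * b) ^ (Suc k + i) * (s + b) ^ (Suc k - i))))"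
proof -
  let ?e = "\<lambda>x. ennreal (erlang_density k b x)"
  \<comment> \<open>The normalising constants of both densities times the \<open>i\<close>-th
    binomial coefficient, that is, the weight of \<open>n ^ (k + i) * x ^ (k - i)\<close>.\<close>
  define C where "C i = b ^ (2 * Suc k) / (fact k)\<^sup>2 * real (k choose i)" for i
  have C: "0 \<le> C i" for i using b by (simp add: C_def)
  let ?N = "\<lambda>i n. ennreal (n ^ (k + i) * exp (- (2 * b * n))) * indicator {0..} n"
  let ?S = "\<lambda>i x. ennreal (x ^ (k - i) * exp (- ((s + b) * x))) * indicator {0..} x"
  have pt: "?e n * ?e (n + x) * ennreal (exp (- (s * x))) * indicator {0..} x
      = (\<Sum>i\<le>k. ennreal (C i) * ?N i n * ?S i x)" for n x
  proof (cases "0 \<le> n \<and> 0 \<le> x")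
    case True
    have "erlang_density k b n * erlang_density k b (n + x) * exp (- (s * x))
        = b ^ (2 * Suc k) / (fact k)\<^sup>2 * (n ^ k * (n + x) ^ k) * exp (- (2 * b * n)) * exp (- ((s + b) * x))"
    proof -
      have "exp (- b * n) * exp (- b * (n + x)) * exp (- (s * x)) = exp (- (2 * b * n)) * exp (- ((s + b) * x))"
        by (simp add: algebra_simps flip: exp_add)
      moreover have "b ^ (2 * Suc k) = b ^ Suc k * b ^ Suc k"
        by (simp only: mult_2 power_add)
      then have "erlang_density k b n * erlang_density k b (n + x) * exp (- (s * x))
          = b ^ (2 * Suc k) / (fact k)\<^sup>2 * (n ^ k * (n + x) ^ k) * (exp (- b * n) * exp (- b * (n + x)) * exp (- (s * x)))"
        using True by (simp add: erlang_density_def power2_eq_square del: power_Suc)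
      ultimately show ?thesis by (simp only: mult.assoc)
    qed
    also have "\<dots> = (\<Sum>i\<le>k. C i * (n ^ (k + i) * exp (- (2 * b * n))) * (x ^ (k - i) * exp (- ((s + b) * x))))"
      unfolding binomial_ring C_def sum_distrib_left sum_distrib_right
      by (intro sum.cong) (auto simp: power_add)
    finally have eq: "erlang_density k b n * erlang_density k b (n + x) * exp (- (s * x)) = \<dots>" .
    have "?e n * ?e (n + x) * ennreal (exp (- (s * x))) * indicator {0..} x
        = ennreal (erlang_density k b n * erlang_density k b (n + x) * exp (- (s * x)))"
      using True b by (simp add: ennreal_mult')
    also have "\<dots> = (\<Sum>i\<le>k. ennreal (C i * (n ^ (k + i) * exp (- (2 * b * n))) * (x ^ (k - i) * exp (- ((s + b) * x)))))"
      unfolding eq using True C by (intro sum_ennreal[symmetric]) auto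
    also have "\<dots> = (\<Sum>i\<le>k. ennreal (C i) * ?N i n * ?S i x)"
      using True C by (intro sum.cong) (auto simp: ennreal_mult)
    finally show ?thesis .
  qed (auto simp: erlang_density_def split: split_indicator)
  have "(\<integral>\<^sup>+n. \<integral>\<^sup>+p. ennreal (exp (- (s * (p - n)))) * indicator {n..} p \<partial>erlang k b \<partial>erlang k b)
      = (\<integral>\<^sup>+n. ?e n * (\<integral>\<^sup>+p. ?e p * (ennreal (exp (- (s * (p - n)))) * indicator {n..} p) \<partial>lborel) \<partial>lborel)"
    using b by (simp add: nn_integral_density indicator_def)
  also have "\<dots> = (\<integral>\<^sup>+n. \<integral>\<^sup>+x. (\<Sum>i\<le>k. ennreal (C i) * ?N i n * ?S i x) \<partial>lborel \<partial>lborel)"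
  proof (rule nn_integral_cong)
    fix n
    have [simp]: "indicator {n..} (n + x) = (indicator {0..} x :: ennreal)" for x :: real
      by (auto split: split_indicator)
    have "(\<integral>\<^sup>+p. ?e p * (ennreal (exp (- (s * (p - n)))) * indicator {n..} p) \<partial>lborel)
        = (\<integral>\<^sup>+x. ?e (n + x) * (ennreal (exp (- (s * x))) * indicator {0..} x) \<partial>lborel)"
      by (subst nn_integral_real_affine[where c = 1 and t = n]) auto
    then show "?e n * (\<integral>\<^sup>+p. ?e p * (ennreal (exp (- (s * (p - n)))) * indicator {n..} p) \<partial>lborel)
        = (\<integral>\<^sup>+x. (\<Sum>i\<le>k. ennreal (C i) * ?N i n * ?S i x) \<partial>lborel)"
      unfolding pt[symmetric] by (simp add: nn_integral_cmult mult.assoc)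
  qed
  also have "\<dots> = (\<Sum>i\<le>k. ennreal (C i) * (\<integral>\<^sup>+n. ?N i n \<partial>lborel) * (\<integral>\<^sup>+x. ?S i x \<partial>lborel))"
    by (simp add: nn_integral_sum nn_integral_cmult nn_integral_multc)
  also have "\<dots> = (\<Sum>i\<le>k. ennreal (C i * (fact (k + i) / (2 * b) ^ Suc (k + i)) * (fact (k - i) / (s + b) ^ Suc (k - i))))"
  proof (intro sum.cong refl)
    fix i
    show "ennreal (C i) * (\<integral>\<^sup>+n. ?N i n \<partial>lborel) * (\<integral>\<^sup>+x. ?S i x \<partial>lborel)
       = ennreal (C i * (fact (k + i) / (2 * b) ^ Suc (k + i)) * (fact (k - i) / (s + b) ^ Suc (k - i)))"
    proof -
      have "0 < 2 * b" "0 < s + b" using b s by auto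
      moreover from this have "0 \<le> fact (k + i) / (2 * b) ^ Suc (k + i)" "0 \<le> fact (k - i) / (s + b) ^ Suc (k - i)"
        by (simp_all del: power_Suc)
      ultimately show ?thesis
        by (simp only: nn_integral_power_exp_Ici ennreal_mult C mult_nonneg_nonneg)
    qed
  qed
  also have "\<dots> = ennreal (\<Sum>i\<le>k. C i * (fact (k + i) / (2 * b) ^ Suc (k + i)) * (fact (k - i) / (s + b) ^ Suc (k - i)))"
    using C b s by (intro sum_ennreal) auto
  also have "(\<Sum>i\<le>k. C i * (fact (k + i) / (2 * b) ^ Suc (k + i)) * (fact (k - i) / (s + b) ^ Suc (k - i)))
      = b ^ (2 * Suc k) * (\<Sum>i\<le>k. real ((k + i) choose i) / ((2 * b) ^ (Suc k + i) * (s + b) ^ (Suc k - i)))"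
    unfolding sum_distrib_left
  proof (intro sum.cong refl)
    fix i assume "i \<in> {..k}"
    then have i: "i \<le> k" by simp
    \<comment> \<open>The factorials from the Gamma integrals, the densities and the binomial
      expansion collapse to a single binomial coefficient.\<close>
    have eq: "real (k choose i) * fact (k - i) * fact (k + i) / (fact k)\<^sup>2 = real ((k + i) choose i)"
      using i by (simp add: binomial_fact power2_eq_square)
    show "C i * (fact (k + i) / (2 * b) ^ Suc (k + i)) * (fact (k - i) / (s + b) ^ Suc (k - i))
       = b ^ (2 * Suc k) * (real ((k + i) choose i) / ((2 * b) ^ (Suc k + i) * (s + b) ^ (Suc k - i)))"
    proof -
      have "C i * (fact (k + i) / (2 * b) ^ Suc (k + i)) * (fact (k - i) / (s + b) ^ Suc (k - i))
        = b ^ (2 * Suc k) * (real (k choose i) * fact (k - i) * fact (k + i) / (fact k)\<^sup>2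
            / ((2 * b) ^ Suc (k + i) * (s + b) ^ Suc (k - i)))"
        by (simp add: C_def mult_ac del: power_Suc)
      then show ?thesis
        unfolding eq using i by (simp add: Suc_diff_le del: power_Suc)
    qed
  qed
  finally show ?thesis .
qed

text \<open>The domain splits at the diagonal into two halves that agree by symmetry, whence the
  factor \<open>2\<close>. The diagonal is counted in only one half, which is harmless because
  Erlang laws have no atoms.\<close>

lemma nn_integral_erlang_abs_diff:
  assumes b: "0 < b" and s: "0 < s"
  shows "(\<integral>\<^sup>+p. \<integral>\<^sup>+n. ennreal (exp (- (s * \<bar>p - n\<bar>))) \<partial>erlang k b \<partial>erlang k b)
    = ennreal (2 * b ^ (2 * Suc k) * (\<Sum>i\<le>k. real ((k + i) choose i) / ((2 * b) ^ (Suc k + i) * (s + b) ^ (Suc k - i))))"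
proof -
  let ?E = "erlang k b"
  interpret E: prob_space ?E by (rule prob_space_erlang_density[OF b])
  let ?A = "\<integral>\<^sup>+n. \<integral>\<^sup>+p. ennreal (exp (- (s * (p - n)))) * indicator {n..} p \<partial>?E \<partial>?E"
  let ?B = "\<integral>\<^sup>+n. \<integral>\<^sup>+p. ennreal (exp (- (s * (n - p)))) * indicator {p<..} n \<partial>?E \<partial>?E"
  have "(\<integral>\<^sup>+n. \<integral>\<^sup>+p. ennreal (exp (- (s * \<bar>n - p\<bar>))) \<partial>?E \<partial>?E)
      = (\<integral>\<^sup>+n. \<integral>\<^sup>+p. ennreal (exp (- (s * (p - n)))) * indicator {n..} p
            + ennreal (exp (- (s * (n - p)))) * indicator {p<..} n \<partial>?E \<partial>?E)"
    by (intro nn_integral_cong) (auto split: split_indicator)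
  also have "\<dots> = ?A + ?B"
    by (simp add: nn_integral_add indicator_def)
  also have "?B = (\<integral>\<^sup>+p. \<integral>\<^sup>+n. ennreal (exp (- (s * (n - p)))) * indicator {p<..} n \<partial>?E \<partial>?E)"
    using b by (rule nn_integral_erlang_swap) (simp add: indicator_def)
  also have "\<dots> = ?A"
  proof (rule nn_integral_cong, rule nn_integral_cong_AE)
    fix p :: real
    have "AE n in ?E. n \<noteq> p"
      using AE_lborel_singleton[of p] by (subst AE_density) auto
    then show "AE n in ?E. ennreal (exp (- (s * (n - p)))) * indicator {p<..} n
       = ennreal (exp (- (s * (n - p)))) * indicator {p..} n"
      by eventually_elim (auto split: split_indicator)
  qed
  finally show ?thesis
    using b s unfolding nn_integral_erlang_ordered[OF b s]
    by (subst (asm) ennreal_plus[symmetric]) (auto intro!: mult_nonneg_nonneg sum_nonneg simp: mult.assoc simp del: power_Suc)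
qed

text \<open>The exponential integral of the gauge, written in coordinates, is
  \<open>(2 / b) ^ d\<close> times the Laplace expectation of
  \<open>exp (- (s * \<bar>z\<bar>))\<close> at the coordinate sum \<open>z\<close>, which the
  Erlang representation evaluates.\<close>

lemma emeasure_sum_abs_sublevel:
  assumes b: "0 < b" and s: "0 < s"
  defines "d \<equiv> DIM('a::euclidean_space)"
  shows "emeasure lborel {y::'a. s * \<bar>\<Sum>i\<in>Basis. y \<bullet> i\<bar> + b * (\<Sum>i\<in>Basis. \<bar>y \<bullet> i\<bar>) \<le> 1}
    = ennreal (2 / fact d * (\<Sum>j<d. real ((d + j - 1) choose j) / ((2 * b) ^ j * (s + b) ^ (d - j))))"
proof -
  let ?h = "\<lambda>y::'a. s * \<bar>\<Sum>i\<in>Basis. y \<bullet> i\<bar> + b * (\<Sum>i\<in>Basis. \<bar>y \<bullet> i\<bar>)"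
  let ?P = "\<Pi>\<^sub>M i\<in>(Basis :: 'a set). lborel :: real measure"
  obtain k where k: "d = Suc k" unfolding d_def using DIM_positive[where 'a='a] by (metis Suc_pred')
  let ?S = "\<Sum>j<d. real ((d + j - 1) choose j) / ((2 * b) ^ j * (s + b) ^ (d - j))"
  have S: "0 \<le> ?S" using b s by (intro sum_nonneg) auto
  have "fact d * emeasure lborel {y. ?h y \<le> 1} = (\<integral>\<^sup>+y. ennreal (exp (- ?h y)) \<partial>lborel)"
    unfolding d_def
  proof (rule nn_integral_exp_minus_gauge[symmetric])
    show "0 \<le> ?h y" for y using b s by (auto intro!: add_nonneg_nonneg mult_nonneg_nonneg sum_nonneg)
    show "?h (t *\<^sub>R y) = t * ?h y" if "0 < t" for t y
      using that by (simp add: abs_mult algebra_simps flip: sum_distrib_left)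
  qed measurable
  also have "\<dots> = (\<integral>\<^sup>+f. ennreal (exp (- ?h (\<Sum>i\<in>Basis. f i *\<^sub>R i))) \<partial>?P)"
    by (subst lborel_eq, subst nn_integral_distr) measurable
  also have "\<dots> = (\<integral>\<^sup>+f. ennreal ((2 / b) ^ d) * ((\<Prod>i\<in>Basis. ennreal (laplace_density b (f i)))
      * ennreal (exp (- (s * \<bar>\<Sum>i\<in>Basis. f i\<bar>)))) \<partial>?P)"
  proof (rule nn_integral_cong)
    fix f :: "'a \<Rightarrow> real"
    have "?h (\<Sum>i\<in>Basis. f i *\<^sub>R i) = s * \<bar>\<Sum>i\<in>Basis. f i\<bar> + (\<Sum>i\<in>Basis. b * \<bar>f i\<bar>)"
      by (simp add: sum_distrib_left)
    then have "exp (- ?h (\<Sum>i\<in>Basis. f i *\<^sub>R i))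
        = (\<Prod>i\<in>(Basis :: 'a set). exp (- (b * \<bar>f i\<bar>))) * exp (- (s * \<bar>\<Sum>i\<in>Basis. f i\<bar>))"
      by (simp add: exp_add[symmetric] sum_negf flip: exp_sum)
    also have "(\<Prod>i\<in>(Basis :: 'a set). exp (- (b * \<bar>f i\<bar>)))
        = (2 / b) ^ d * (\<Prod>i\<in>(Basis :: 'a set). laplace_density b (f i))"
    proof -
      have "(\<Prod>i\<in>(Basis :: 'a set). exp (- (b * \<bar>f i\<bar>))) = (\<Prod>i\<in>(Basis :: 'a set). 2 / b * laplace_density b (f i))"
        using b by (intro prod.cong) auto
      also have "\<dots> = (\<Prod>i\<in>(Basis :: 'a set). 2 / b) * (\<Prod>i\<in>(Basis :: 'a set). laplace_density b (f i))"
        by (rule prod.distrib)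
      finally show ?thesis by (simp only: prod_constant d_def)
    qed
    finally show "ennreal (exp (- ?h (\<Sum>i\<in>Basis. f i *\<^sub>R i)))
      = ennreal ((2 / b) ^ d) * ((\<Prod>i\<in>(Basis :: 'a set). ennreal (laplace_density b (f i)))
      * ennreal (exp (- (s * \<bar>\<Sum>i\<in>Basis. f i\<bar>))))"
      using b by (simp add: prod_ennreal prod_nonneg ennreal_mult' mult.assoc)
  qed
  also have "\<dots> = ennreal ((2 / b) ^ d) * (\<integral>\<^sup>+f. (\<Prod>i\<in>Basis. ennreal (laplace_density b (f i)))
      * ennreal (exp (- (s * \<bar>\<Sum>i\<in>Basis. f i\<bar>))) \<partial>?P)"
    by (rule nn_integral_cmult) measurable
  also have "\<dots> = ennreal ((2 / b) ^ d) *
      (\<integral>\<^sup>+p. \<integral>\<^sup>+n. ennreal (exp (- (s * \<bar>p - n\<bar>))) \<partial>erlang (d - 1) b \<partial>erlang (d - 1) b)"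
    unfolding d_def using b by (subst nn_integral_prod_laplace_sum) auto
  also have "\<dots> = ennreal ((2 / b) ^ d * (2 * b ^ (2 * d) *
      (\<Sum>i<d. real ((d + i - 1) choose i) / ((2 * b) ^ (d + i) * (s + b) ^ (d - i)))))"
    using b nn_integral_erlang_abs_diff[OF b s, of k]
    by (simp add: k lessThan_Suc_atMost ennreal_mult' del: power_Suc)
  \<comment> \<open>The prefactors combine to \<open>2 * (2 * b) ^ d\<close>, which cancels the
    \<open>d\<close>-th power inside each \<open>(2 * b) ^ (d + i)\<close>.\<close>
  also have "(2 / b) ^ d * (2 * b ^ (2 * d) *
      (\<Sum>i<d. real ((d + i - 1) choose i) / ((2 * b) ^ (d + i) * (s + b) ^ (d - i)))) = 2 * ?S"
  proof -
    have "(2 / b) ^ d * b ^ (2 * d) = (2 * b) ^ d"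
    proof -
      have "(2 / b) ^ d * b ^ (2 * d) = (2 / b * b\<^sup>2) ^ d"
        by (simp only: power_mult power_mult_distrib)
      also have "2 / b * b\<^sup>2 = 2 * b"
        using b by (simp add: power2_eq_square)
      finally show ?thesis .
    qed
    moreover have "(2 / b) ^ d * (2 * b ^ (2 * d) * T) = 2 * (((2 / b) ^ d * b ^ (2 * d)) * T)" for T
      by (simp only: mult_ac)
    ultimately have comb: "(2 / b) ^ d * (2 * b ^ (2 * d) * T) = 2 * ((2 * b) ^ d * T)" for T
      by simp
    have "(2 * b) ^ d * (\<Sum>i<d. real ((d + i - 1) choose i) / ((2 * b) ^ (d + i) * (s + b) ^ (d - i))) = ?S"
      unfolding sum_distrib_left using b by (intro sum.cong refl) (simp add: power_add)
    then show ?thesis unfolding comb by simp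
  qed
  finally have "emeasure lborel {y. ?h y \<le> 1} * ennreal (fact d) = ennreal (2 * ?S)"
    by (simp only: ennreal_fact mult.commute)
  then have "emeasure lborel {y. ?h y \<le> 1} = ennreal (2 * ?S) / ennreal (fact d)"
    using mult_divide_eq_ennreal[of "ennreal (fact d)" "emeasure lborel {y. ?h y \<le> 1}"] by simp
  also have "\<dots> = ennreal (2 / fact d * ?S)"
    using S by (simp add: divide_ennreal)
  finally show ?thesis .
qed

section \<open>Specialisation to coordinate vectors and the final formula\<close>

lemma sum_Basis_vec:
  fixes y :: "real ^ 'n"
  shows "(\<Sum>i\<in>Basis. f (y \<bullet> i)) = (\<Sum>i\<in>UNIV. f (y $ i))"
proof -
  have "(\<Sum>i\<in>Basis. f (y \<bullet> i)) = (\<Sum>i\<in>range (\<lambda>i. axis i (1::real)). f (y \<bullet> i))"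
    by (intro sum.cong) (auto simp: Basis_vec_def)
  also have "\<dots> = (\<Sum>i\<in>UNIV. f (y $ i))"
    by (subst sum.reindex) (auto simp: inj_on_def axis_eq_axis inner_axis)
  finally show ?thesis .
qed

theorem corollary6p25:
  assumes "CARD('d::finite) \<ge> 2"
  shows "let d = CARD('d);
             V = (\<lambda>l a :: real. 2 ^ (d + 1) / (l ^ d * fact d) *
                   (\<Sum>j = 0..d - 1. real ((d + j - 1) choose j) * (l / (2 * (l - a))) ^ j));
             D = {(l, a). l \<noteq> 0 \<and> l \<noteq> a}
         in (\<forall>l a. 0 < a \<and> a < l \<longrightarrow>
               measure lebesgue (polar_dual (isocanted_cube l a :: (real ^ 'd) set)) = V l a) \<and>
            rational_on D V \<and> homogeneous_on D (- int d) V"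
proof -
  define d where "d = CARD('d)"
  have "measure lebesgue (polar_dual (isocanted_cube l a :: (real ^ 'd) set))
      = 2 ^ (d + 1) / (l ^ d * fact d) * (\<Sum>j = 0..d - 1. real ((d + j - 1) choose j) * (l / (2 * (l - a))) ^ j)"
    if a: "0 < a" and al: "a < l" for l a
  proof -
    have l: "0 < l" using a al by simp
    have Basis: "(\<Sum>i\<in>Basis. f (y \<bullet> i)) = (\<Sum>i\<in>UNIV. f (y $ i))" for y :: "real ^ 'd" and f :: "real \<Rightarrow> real"
      by (rule sum_Basis_vec)
    let ?K = "{y :: real ^ 'd. a / 2 * \<bar>\<Sum>i\<in>UNIV. y $ i\<bar> + (l - a) / 2 * (\<Sum>i\<in>UNIV. \<bar>y $ i\<bar>) \<le> 1}"
    let ?S = "\<Sum>j<d. real ((d + j - 1) choose j) / ((2 * ((l - a) / 2)) ^ j * (a / 2 + (l - a) / 2) ^ (d - j))"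
    have "measure lebesgue (polar_dual (isocanted_cube l a :: (real ^ 'd) set)) = measure lborel ?K"
      unfolding polar_dual_isocanted_cube[OF a al] by (rule measure_completion) measurable
    also have "\<dots> = 2 / fact d * ?S"
      using emeasure_sum_abs_sublevel[of "(l - a) / 2" "a / 2", where 'a = "real ^ 'd"] a al
        Basis[of "\<lambda>x. x"] Basis[of abs]
      by (simp add: measure_def d_def sum_nonneg)
    \<comment> \<open>Here \<open>s + b = l / 2\<close> and \<open>2 * b = l - a\<close>; extracting
      \<open>(2 / l) ^ d\<close> turns \<open>(l / 2) ^ (d - j)\<close> in the denominator into
      \<open>(l / 2) ^ j\<close> in the numerator.\<close>
    also have "?S = (\<Sum>j<d. (2 / l) ^ d * (real ((d + j - 1) choose j) * (l / (2 * (l - a))) ^ j))"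
    proof (intro sum.cong refl)
      fix j assume "j \<in> {..<d}"
      then have "(l / 2) ^ (d - j) = (l / 2) ^ d / (l / 2) ^ j"
        using l by (simp add: power_diff)
      moreover have "a / 2 + (l - a) / 2 = l / 2" by (simp add: field_simps)
      moreover have "2 * ((l - a) / 2) = l - a" by simp
      ultimately show "real ((d + j - 1) choose j) / ((2 * ((l - a) / 2)) ^ j * (a / 2 + (l - a) / 2) ^ (d - j))
          = (2 / l) ^ d * (real ((d + j - 1) choose j) * (l / (2 * (l - a))) ^ j)"
        using l al by (simp add: power_divide power_mult_distrib field_simps)
    qed
    \<comment> \<open>Positivity of \<open>d\<close> matters here: with truncated subtraction the
      right-hand side would be \<open>{0}\<close> for \<open>d = 0\<close>.\<close>
    also have "{..<d} = {0..d - 1}"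
      using assms unfolding d_def by (auto simp: less_eq_Suc_le)
    finally show ?thesis
      unfolding sum_distrib_left[symmetric] by (simp add: power_divide mult_ac)
  qed
  then show ?thesis
    using polar_volume_rational_on[of d] polar_volume_homogeneous_on[of _ d]
    unfolding Let_def d_def by blast
qed

end
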